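(* Let $E$ be an energy form on $L^0(m)$. If $1\in D(E)$, then $E$ is the only Silverstein extension of $E$. In particular, every recurrent energy form is Silverstein unique.
   Context: $(X,\mathcal B,m)$ is a measure space with $m$ localizable: $m$ is semi-finite and every family $\mathcal A\subseteq\mathcal B$ has an essential supremum $S\in\mathcal B$, i.e. $m(A\setminus S)=0$ for all $A\in\mathcal A$, and $m(S\setminus G)=0$ whenever $G\in\mathcal B$ satisfies $m(A\setminus G)=0$ for all $A\in\mathcal A$. $L^0(m)$ is the space of real-valued measurable functions modulo $m$-a.e. equality, with the topology $\tau(m)$ of local convergence in measure: $f_i\to f$ iff $\int_U|f_i-f|\wedge1\,dm\to0$ for every measurable $U$ with $m(U)<\infty$. A quadratic form on $L^0(m)$ is a map $q:L^0(m)\to[0,\infty]$ with $2q(u)+2q(v)=q(u+v)+q(u-v)$ and $q(\lambda u)=|\lambda|^2q(u)$ ($0\cdot\infty=0$); $D(q)=\{q<\infty\}$, $\ker q=\{q=0\}$. It is closed if $D(q)$ is complete in the form topology, the smallest topology containing the subspace topology of $\tau(m)$ and the topology of the seminorm $q^{1/2}$. $\tilde q$ is an extension of $q$ if $D(q)\subseteq D(\tilde q)$ and $\tilde q=q$ on $D(q)$. An $\varepsilon$-cutoff is a monotone increasing map $C:\mathbb R\to[-\varepsilon,1+\varepsilon]$ with $|C(x)-C(y)|\le|x-y|$ and $C(x)=x$ for $x\in[0,1]$. A quadratic form $E$ on $L^0(m)$ is Markovian if for each $\varepsilon>0$ there is an $\varepsilon$-cutoff $C_\varepsilon$ with $E(C_\varepsilon\circ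 f)\le E(f)$ for all $f\in L^0(m)$; an energy form is a closed Markovian form on $L^0(m)$. A Silverstein extension of an energy form $E$ is an energy form $\widetilde E$ extending $E$ such that $D(E)\cap L^\infty(m)$ is an algebraic ideal in $D(\widetilde E)\cap L^\infty(m)$, i.e. $fg\in D(E)$ for all $f\in D(E)\cap L^\infty(m)$, $g\in D(\widetilde E)\cap L^\infty(m)$ (equivalently, $D(E)$ is an order ideal in $D(\widetilde E)$). $E$ is Silverstein unique if $E$ is its only Silverstein extension. $E$ is recurrent if $1\in\ker E$. *)

theory Defs
  imports "HOL-Analysis.Analysis"
begin

text \<open>
  Elements of \<open>L\<^sup>0(m)\<close> are represented by measurable functions: a functional on \<open>L\<^sup>0(m)\<close> is a
  functional on functions that respects a.e. equality on \<open>borel_measurable M\<close> (its values at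
  non-measurable functions carry no meaning), and a topology on a subset of \<open>L\<^sup>0(m)\<close> is given by
  its preimage under the quotient map. Completeness is not affected by this.
\<close>

text \<open>
  The library locale \<open>semifinite_measure\<close> does not require the subset of finite measure to have
  positive measure, so it is satisfied by every measure (take the empty set) and cannot be used.
\<close>

definition semi_finite :: "'a measure \<Rightarrow> bool" where
  "semi_finite M \<longleftrightarrow>
    (\<forall>A\<in>sets M. emeasure M A = \<infinity> \<longrightarrow>
      (\<exists>B\<in>sets M. B \<subseteq> A \<and> 0 < emeasure M B \<and> emeasure M B < \<infinity>))"

definition localizable :: "'a measure \<Rightarrow> bool" where
  "localizable M \<longleftrightarrow> semi_finite M \<and>
    (\<forall>\<A>. \<A> \<subseteq> sets M \<longrightarrow>
      (\<exists>S\<in>sets M. (\<forall>A\<in>\<A>. emeasure M (A - S) = 0) \<and>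
        (\<forall>G\<in>sets M. (\<forall>A\<in>\<A>. emeasure M (A - G) = 0) \<longrightarrow> emeasure M (S - G) = 0)))"

text \<open>
  The topology \<open>\<tau>(m)\<close> of local convergence in measure, generated by the balls of the
  pseudometrics \<open>(f, g) \<mapsto> \<integral>\<^sub>U |f - g| \<and> 1 dm\<close> with \<open>m(U) < \<infinity>\<close>.
\<close>

definition local_measure_topology :: "'a measure \<Rightarrow> ('a \<Rightarrow> real) topology" where
  "local_measure_topology M = topology_generated_by
    {{g \<in> borel_measurable M. (LINT x:U|M. min \<bar>f x - g x\<bar> 1) < r} | f U r.
      f \<in> borel_measurable M \<and> U \<in> sets M \<and> emeasure M U < \<infinity> \<and> 0 < r}"

definition quadratic_form :: "'a measure \<Rightarrow> (('a \<Rightarrow> real) \<Rightarrow> ennreal) \<Rightarrow> bool" where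
  "quadratic_form M q \<longleftrightarrow>
    (\<forall>u\<in>borel_measurable M. \<forall>v\<in>borel_measurable M. (AE x in M. u x = v x) \<longrightarrow> q u = q v) \<and>
    (\<forall>u\<in>borel_measurable M. \<forall>v\<in>borel_measurable M.
      2 * q u + 2 * q v = q (\<lambda>x. u x + v x) + q (\<lambda>x. u x - v x)) \<and>
    (\<forall>u\<in>borel_measurable M. \<forall>c::real. q (\<lambda>x. c * u x) = ennreal (\<bar>c\<bar>\<^sup>2) * q u)"

definition form_domain :: "'a measure \<Rightarrow> (('a \<Rightarrow> real) \<Rightarrow> ennreal) \<Rightarrow> ('a \<Rightarrow> real) set" where
  "form_domain M q = {f \<in> borel_measurable M. q f < \<infinity>}"

definition form_kernel :: "'a measure \<Rightarrow> (('a \<Rightarrow> real) \<Rightarrow> ennreal) \<Rightarrow> ('a \<Rightarrow> real) set" where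
  "form_kernel M q = {f \<in> borel_measurable M. q f = 0}"

definition form_seminorm_topology ::
    "'a measure \<Rightarrow> (('a \<Rightarrow> real) \<Rightarrow> ennreal) \<Rightarrow> ('a \<Rightarrow> real) topology" where
  "form_seminorm_topology M q = topology_generated_by
    {{g \<in> form_domain M q. sqrt (enn2real (q (\<lambda>x. f x - g x))) < r} | f r.
      f \<in> form_domain M q \<and> 0 < r}"

definition form_topology ::
    "'a measure \<Rightarrow> (('a \<Rightarrow> real) \<Rightarrow> ennreal) \<Rightarrow> ('a \<Rightarrow> real) topology" where
  "form_topology M q = topology_generated_by
    ({V. openin (subtopology (local_measure_topology M) (form_domain M q)) V} \<union>
     {V. openin (form_seminorm_topology M q) V})"

text \<open>
  Completeness of a vector space of functions carrying a vector space topology, with respect to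
  the uniform structure induced by the topology: every Cauchy filter on the space converges.
\<close>

definition Cauchy_filter :: "('a \<Rightarrow> real) topology \<Rightarrow> ('a \<Rightarrow> real) filter \<Rightarrow> bool" where
  "Cauchy_filter T F \<longleftrightarrow> F \<noteq> bot \<and> eventually (\<lambda>f. f \<in> topspace T) F \<and>
    (\<forall>N. openin T N \<and> (\<lambda>_. 0) \<in> N \<longrightarrow>
      (\<exists>A. eventually (\<lambda>f. f \<in> A) F \<and> (\<forall>f\<in>A. \<forall>g\<in>A. (\<lambda>x. f x - g x) \<in> N)))"

definition complete_topology :: "('a \<Rightarrow> real) topology \<Rightarrow> bool" where
  "complete_topology T \<longleftrightarrow> (\<forall>F. Cauchy_filter T F \<longrightarrow> (\<exists>f. limitin T (\<lambda>g. g) f F))"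

definition closed_form :: "'a measure \<Rightarrow> (('a \<Rightarrow> real) \<Rightarrow> ennreal) \<Rightarrow> bool" where
  "closed_form M q \<longleftrightarrow> quadratic_form M q \<and> complete_topology (form_topology M q)"

definition form_extension ::
    "'a measure \<Rightarrow> (('a \<Rightarrow> real) \<Rightarrow> ennreal) \<Rightarrow> (('a \<Rightarrow> real) \<Rightarrow> ennreal) \<Rightarrow> bool" where
  "form_extension M q q' \<longleftrightarrow>
    form_domain M q \<subseteq> form_domain M q' \<and> (\<forall>f\<in>form_domain M q. q' f = q f)"

definition cutoff :: "real \<Rightarrow> (real \<Rightarrow> real) \<Rightarrow> bool" where
  "cutoff \<epsilon> C \<longleftrightarrow> mono C \<and> range C \<subseteq> {-\<epsilon>..1 + \<epsilon>} \<and>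
    (\<forall>x y. \<bar>C x - C y\<bar> \<le> \<bar>x - y\<bar>) \<and> (\<forall>x\<in>{0..1}. C x = x)"

definition Markovian :: "'a measure \<Rightarrow> (('a \<Rightarrow> real) \<Rightarrow> ennreal) \<Rightarrow> bool" where
  "Markovian M E \<longleftrightarrow>
    (\<forall>\<epsilon>>0. \<exists>C. cutoff \<epsilon> C \<and> (\<forall>f\<in>borel_measurable M. E (C \<circ> f) \<le> E f))"

definition energy_form :: "'a measure \<Rightarrow> (('a \<Rightarrow> real) \<Rightarrow> ennreal) \<Rightarrow> bool" where
  "energy_form M E \<longleftrightarrow> closed_form M E \<and> Markovian M E"

definition ess_bounded :: "'a measure \<Rightarrow> ('a \<Rightarrow> real) set" where
  "ess_bounded M = {f \<in> borel_measurable M. \<exists>c. AE x in M. \<bar>f x\<bar> \<le> c}"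

definition Silverstein_extension ::
    "'a measure \<Rightarrow> (('a \<Rightarrow> real) \<Rightarrow> ennreal) \<Rightarrow> (('a \<Rightarrow> real) \<Rightarrow> ennreal) \<Rightarrow> bool" where
  "Silverstein_extension M E E' \<longleftrightarrow> energy_form M E' \<and> form_extension M E E' \<and>
    (\<forall>f \<in> form_domain M E \<inter> ess_bounded M. \<forall>g \<in> form_domain M E' \<inter> ess_bounded M.
      (\<lambda>x. f x * g x) \<in> form_domain M E)"

text \<open>
  Being the only Silverstein extension of itself includes being one. Equality of functionals on
  \<open>L\<^sup>0(m)\<close> is equality on \<open>borel_measurable M\<close>.
\<close>

definition Silverstein_unique :: "'a measure \<Rightarrow> (('a \<Rightarrow> real) \<Rightarrow> ennreal) \<Rightarrow> bool" where
  "Silverstein_unique M E \<longleftrightarrow> Silverstein_extension M E E \<and>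
    (\<forall>E'. Silverstein_extension M E E' \<longrightarrow> (\<forall>f\<in>borel_measurable M. E' f = E f))"

definition recurrent :: "'a measure \<Rightarrow> (('a \<Rightarrow> real) \<Rightarrow> ennreal) \<Rightarrow> bool" where
  "recurrent M E \<longleftrightarrow> (\<lambda>_. 1) \<in> form_kernel M E"

end

theory Submission
  imports Defs
begin

text \<open>
  Completeness makes a closed form lower semicontinuous: a sequence with bounded form values has
  averages that are Cauchy in the form topology and still converge to the same limit. Positive parts
  are limits of bounded functions obtained from cutoffs, without increase of the form. If \<open>1 \<in> D(E)\<close>, the ideal property puts \<open>1 \<cdot> g\<close> into \<open>D(E)\<close> for every bounded \<open>g\<close> in
  the domain of a Silverstein extension, and lower semicontinuity of \<open>E\<close> extends this to all \<open>g\<close>.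
  That \<open>E\<close> is a Silverstein extension of itself also uses \<open>1 \<in> D(E)\<close>: for bounded \<open>f \<ge> 0\<close> in \<open>D(E)\<close>
  the square \<open>2 \<integral>\<^sub>0\<^sup>\<infinity> (f - a)\<^sup>+ da\<close> is a limit of averages with bounded form values, and products
  follow by polarization.
\<close>

subsection \<open>Quadratic forms\<close>

lemma quadratic_form_cong_AE:
  assumes "quadratic_form M q" "u \<in> borel_measurable M" "v \<in> borel_measurable M"
    and "AE x in M. u x = v x"
  shows "q u = q v"
  using assms unfolding quadratic_form_def by blast

lemma quadratic_form_parallelogram:
  assumes "quadratic_form M q" "u \<in> borel_measurable M" "v \<in> borel_measurable M"
  shows "2 * q u + 2 * q v = q (\<lambda>x. u x + v x) + q (\<lambda>x. u x - v x)"
  using assms unfolding quadratic_form_def by blast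

lemma quadratic_form_scale:
  assumes "quadratic_form M q" "u \<in> borel_measurable M"
  shows "q (\<lambda>x. c * u x) = ennreal (c\<^sup>2) * q u"
proof -
  have "q (\<lambda>x. c * u x) = ennreal (\<bar>c\<bar>\<^sup>2) * q u"
    using assms unfolding quadratic_form_def by blast
  then show ?thesis by (simp only: power2_abs)
qed

lemma quadratic_form_zero:
  assumes "quadratic_form M q"
  shows "q (\<lambda>_. 0) = 0"
  using quadratic_form_scale[OF assms, of "\<lambda>_. 0" 0] by simp

lemma quadratic_form_add_le:
  assumes "quadratic_form M q" "u \<in> borel_measurable M" "v \<in> borel_measurable M"
  shows "q (\<lambda>x. u x + v x) \<le> 2 * q u + 2 * q v"
  using quadratic_form_parallelogram[OF assms] by simp

text \<open>The parallelogram law for \<open>u / 2\<close> and \<open>v / 2\<close>, with the value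
  at their difference dropped; scaling turns the factor \<open>2\<close> into
  \<open>2 * (1/2)^2 = 1/2\<close>.\<close>

lemma quadratic_form_midpoint:
  assumes q: "quadratic_form M q" and [measurable]: "u \<in> borel_measurable M" "v \<in> borel_measurable M"
  shows "q (\<lambda>x. (u x + v x) / 2) \<le> ennreal (1/2) * q u + ennreal (1/2) * q v"
proof -
  have *: "2 * (ennreal ((1/2)\<^sup>2) * q w) = ennreal (1/2) * q w" for w
  proof -
    have "2 * ennreal ((1/2)\<^sup>2) = ennreal (1/2)"
      by (simp add: ennreal_mult'[symmetric] power2_eq_square flip: ennreal_numeral)
    then show ?thesis by (simp add: mult.assoc[symmetric])
  qed
  have "q (\<lambda>x. (1/2) * u x + (1/2) * v x) \<le> 2 * q (\<lambda>x. (1/2) * u x) + 2 * q (\<lambda>x. (1/2) * v x)"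
    by (rule quadratic_form_add_le[OF q]) auto
  also have "\<dots> = ennreal (1/2) * q u + ennreal (1/2) * q v"
    by (subst (1 2) quadratic_form_scale[OF q]) (auto simp: *)
  finally show ?thesis by (simp add: add_divide_distrib)
qed

lemma ennreal_average_le:
  fixes B :: ennreal
  assumes "a \<le> B" "b \<le> B"
  shows "ennreal (1/2) * a + ennreal (1/2) * b \<le> B"
proof -
  have "ennreal (1/2) * a + ennreal (1/2) * b \<le> ennreal (1/2) * B + ennreal (1/2) * B"
    using assms by (intro add_mono mult_left_mono) auto
  also have "\<dots> = (ennreal (1/2) + ennreal (1/2)) * B" by (simp add: distrib_right)
  also have "\<dots> = B" by (subst ennreal_plus[symmetric]) auto
  finally show ?thesis .
qed

lemma quadratic_form_midpoint_le:
  assumes "quadratic_form M q" "u \<in> borel_measurable M" "v \<in> borel_measurable M" "q u \<le> B" "q v \<le> B"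
  shows "q (\<lambda>x. (u x + v x) / 2) \<le> B"
  using quadratic_form_midpoint[OF assms(1-3)] ennreal_average_le[OF assms(4,5)] by (rule order_trans)

text \<open>Splitting \<open>2^(m+1)\<close> terms into two blocks makes their average a midpoint of
  two block averages, so midpoint convexity suffices. This later bounds Riemann sums with
  \<open>2^m\<close> terms.\<close>

lemma quadratic_form_dyadic_average_le:
  fixes u :: "nat \<Rightarrow> 'a \<Rightarrow> real"
  assumes q: "quadratic_form M q" and "\<And>k. u k \<in> borel_measurable M" "\<And>k. q (u k) \<le> B"
  shows "q (\<lambda>x. (\<Sum>k<2^m. u k x) / 2^m) \<le> B"
  using assms(2,3)
proof (induction m arbitrary: u)
  case 0
  then show ?case by simp
next
  case (Suc m)
  note [measurable] = Suc.prems(1)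
  have split: "(\<Sum>k<2^Suc m. u k x) = (\<Sum>k<2^m. u k x) + (\<Sum>k<2^m. u (k + 2^m) x)" for x
  proof -
    have "(\<Sum>k\<in>{2^m..<2^m + 2^m}. u k x) = (\<Sum>k<2^m. u (k + 2^m) x)"
      using sum.shift_bounds_nat_ivl[of "\<lambda>k. u k x" 0 "2^m" "2^m"] by (simp add: atLeast0LessThan)
    then show ?thesis
      using sum.atLeastLessThan_concat[of 0 "2^m" "2^m + 2^m" "\<lambda>k. u k x"]
      by (simp add: atLeast0LessThan mult_2)
  qed
  have "q (\<lambda>x. ((\<Sum>k<2^m. u k x) / 2^m + (\<Sum>k<2^m. u (k + 2^m) x) / 2^m) / 2) \<le> B"
    by (rule quadratic_form_midpoint_le[OF q]) (auto intro!: Suc.IH Suc.prems)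
  moreover have "(\<Sum>k<2^Suc m. u k x) / 2^Suc m
      = ((\<Sum>k<2^m. u k x) / 2^m + (\<Sum>k<2^m. u (k + 2^m) x) / 2^m) / 2" for x
    unfolding split by (simp add: add_divide_distrib)
  ultimately show ?case by (simp only:)
qed

text \<open>Induction along the segment from \<open>v\<close> towards \<open>u\<close>: each step
  takes the midpoint of \<open>u\<close> and the previous point, which halves the weight of
  \<open>v\<close>.\<close>

lemma quadratic_form_dyadic_convex:
  assumes q: "quadratic_form M q" and [measurable]: "u \<in> borel_measurable M" "v \<in> borel_measurable M"
  shows "q (\<lambda>x. (1 - (1/2)^k) * u x + (1/2)^k * v x) \<le> ennreal (1 - (1/2)^k) * q u + ennreal ((1/2)^k) * q v"
proof (induction k)
  case 0
  then show ?case by simp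
next
  case (Suc k)
  let ?w = "\<lambda>x. (1 - (1/2)^k) * u x + (1/2)^k * v x"
  have le: "(1/2::real)^k \<le> 1" by (simp add: power_le_one)
  have "(\<lambda>x. (1 - (1/2)^Suc k) * u x + (1/2)^Suc k * v x) = (\<lambda>x. (u x + ?w x) / 2)"
    by (auto simp: field_simps)
  then have "q (\<lambda>x. (1 - (1/2)^Suc k) * u x + (1/2)^Suc k * v x)
      \<le> ennreal (1/2) * q u + ennreal (1/2) * q ?w"
    using quadratic_form_midpoint[OF q, of u ?w] by simp
  also have "\<dots> \<le> ennreal (1/2) * q u + ennreal (1/2) * (ennreal (1 - (1/2)^k) * q u + ennreal ((1/2)^k) * q v)"
    by (intro add_mono mult_left_mono Suc.IH) auto
  also have "\<dots> = (ennreal (1/2) + ennreal (1/2) * ennreal (1 - (1/2)^k)) * q u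
      + (ennreal (1/2) * ennreal ((1/2)^k)) * q v"
    by (simp add: algebra_simps)
  also have "ennreal (1/2) + ennreal (1/2) * ennreal (1 - (1/2)^k) = ennreal (1/2 + 1/2 * (1 - (1/2)^k))"
    using le by (subst ennreal_mult'[symmetric], simp, subst ennreal_plus[symmetric]) auto
  also have "1/2 + 1/2 * (1 - (1/2)^k) = (1 - (1/2)^Suc k :: real)" by (simp add: field_simps)
  also have "ennreal (1/2) * ennreal ((1/2)^k) = ennreal ((1/2)^Suc k)"
    by (subst ennreal_mult'[symmetric]) auto
  finally show ?case .
qed

text \<open>
  Substitutes for the triangle inequality of \<open>q\<^sup>1\<^sup>/\<^sup>2\<close>: the factor in front of \<open>q u\<close> is
  arbitrarily close to 1. Only dyadic weights, and hence no bilinear form, are needed.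
\<close>

lemma quadratic_form_add_le_dyadic:
  assumes q: "quadratic_form M q" and [measurable]: "u \<in> borel_measurable M" "v \<in> borel_measurable M"
    and k: "k > 0"
  shows "q (\<lambda>x. u x + v x) \<le> ennreal (1 / (1 - (1/2)^k)) * q u + ennreal (2^k) * q v"
proof -
  define c :: real where "c = 1 - (1/2)^k"
  have c: "c > 0" using k power_Suc_less_one[of "1/2::real" "k - 1"] by (simp add: c_def)
  have sq1: "ennreal c * ennreal ((1/c)\<^sup>2) = ennreal (1/c)"
    using c by (simp add: ennreal_mult'[symmetric] power2_eq_square)
  have sq2: "ennreal ((1/2)^k) * ennreal ((2^k)\<^sup>2) = ennreal (2^k)"
    by (simp add: ennreal_mult'[symmetric] power2_eq_square field_simps)
  \<comment> \<open>The weights \<open>c\<close> and \<open>(1/2)^k\<close> sum to 1, so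
    \<open>u + v\<close> is a convex combination of \<open>u / c\<close> and \<open>2^k * v\<close>;
    the squares from scaling leave the factors \<open>1 / c\<close> and \<open>2^k\<close>.\<close>
  have "(\<lambda>x. u x + v x) = (\<lambda>x. c * ((1/c) * u x) + (1/2)^k * (2^k * v x))"
    using c by (auto simp: field_simps)
  then have "q (\<lambda>x. u x + v x) \<le> ennreal c * q (\<lambda>x. (1/c) * u x) + ennreal ((1/2)^k) * q (\<lambda>x. 2^k * v x)"
    using quadratic_form_dyadic_convex[OF q, of "\<lambda>x. (1/c) * u x" "\<lambda>x. 2^k * v x" k]
    unfolding c_def by simp
  also have "\<dots> = (ennreal c * ennreal ((1/c)\<^sup>2)) * q u
      + (ennreal ((1/2)^k) * ennreal ((2^k)\<^sup>2)) * q v"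
    by (simp only: quadratic_form_scale[OF q assms(2)] quadratic_form_scale[OF q assms(3)] mult.assoc)
  also have "\<dots> = ennreal (1/c) * q u + ennreal (2^k) * q v"
    by (simp only: sq1 sq2)
  finally show ?thesis unfolding c_def .
qed

section \<open>The form domain as a vector space\<close>

lemma form_domainI: "f \<in> borel_measurable M \<Longrightarrow> q f < \<infinity> \<Longrightarrow> f \<in> form_domain M q"
  and form_domain_measurable: "f \<in> form_domain M q \<Longrightarrow> f \<in> borel_measurable M"
  and form_domain_finite: "f \<in> form_domain M q \<Longrightarrow> q f < \<infinity>"
  unfolding form_domain_def by auto

lemma form_domain_scale:
  assumes q: "quadratic_form M q" and u: "u \<in> form_domain M q"
  shows "(\<lambda>x. c * u x) \<in> form_domain M q"
proof (rule form_domainI)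
  have [measurable]: "u \<in> borel_measurable M" and fin: "q u < \<infinity>"
    using u by (simp_all add: form_domain_def)
  show "(\<lambda>x. c * u x) \<in> borel_measurable M" by measurable
  have "q (\<lambda>x. c * u x) = ennreal (c\<^sup>2) * q u"
    by (rule quadratic_form_scale[OF q]) measurable
  also have "\<dots> < \<infinity>" using fin by (simp add: ennreal_mult_less_top)
  finally show "q (\<lambda>x. c * u x) < \<infinity>" .
qed

lemma form_domain_add:
  assumes q: "quadratic_form M q" and u: "u \<in> form_domain M q" and v: "v \<in> form_domain M q"
  shows "(\<lambda>x. u x + v x) \<in> form_domain M q"
proof (rule form_domainI)
  have [measurable]: "u \<in> borel_measurable M" "v \<in> borel_measurable M"
    using u v by (simp_all add: form_domain_def)
  show "(\<lambda>x. u x + v x) \<in> borel_measurable M" by measurable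
  have "q (\<lambda>x. u x + v x) \<le> 2 * q u + 2 * q v" by (rule quadratic_form_add_le[OF q]) auto
  also have "\<dots> < \<infinity>"
    using u v by (simp add: form_domain_def ennreal_mult_less_top)
  finally show "q (\<lambda>x. u x + v x) < \<infinity>" .
qed

lemma form_domain_diff:
  assumes q: "quadratic_form M q" and u: "u \<in> form_domain M q" and v: "v \<in> form_domain M q"
  shows "(\<lambda>x. u x - v x) \<in> form_domain M q"
proof -
  have "(\<lambda>x. u x - v x) = (\<lambda>x. u x + (-1) * v x)" by simp
  then show ?thesis using form_domain_add[OF q u form_domain_scale[OF q v, of "-1"]] by (simp only:)
qed

lemma form_domain_add_const:
  assumes "quadratic_form M q" "u \<in> form_domain M q" "(\<lambda>_. 1) \<in> form_domain M q"
  shows "(\<lambda>x. u x + c) \<in> form_domain M q"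
proof -
  have "(\<lambda>x. u x + c) = (\<lambda>x. u x + c * 1)" by simp
  then show ?thesis
    using form_domain_add[OF assms(1,2) form_domain_scale[OF assms(1,3), of c]] by (simp only:)
qed

lemma quadratic_form_diff_commute:
  assumes q: "quadratic_form M q" and [measurable]: "u \<in> borel_measurable M" "v \<in> borel_measurable M"
  shows "q (\<lambda>x. u x - v x) = q (\<lambda>x. v x - u x)"
proof -
  have "q (\<lambda>x. u x - v x) = q (\<lambda>x. (-1) * (v x - u x))" by simp
  also have "\<dots> = ennreal ((-1)\<^sup>2) * q (\<lambda>x. v x - u x)"
    by (rule quadratic_form_scale[OF q]) measurable
  finally show ?thesis by simp
qed

lemma enn2real_form_add_le_dyadic:
  assumes q: "quadratic_form M q" and u: "u \<in> form_domain M q" and v: "v \<in> form_domain M q" and k: "k > 0"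
  shows "enn2real (q (\<lambda>x. u x + v x)) \<le> enn2real (q u) / (1 - (1/2)^k) + 2^k * enn2real (q v)"
proof -
  have c: "1 - (1/2)^k > (0::real)" using k power_Suc_less_one[of "1/2::real" "k - 1"] by simp
  have eq: "q w = ennreal (enn2real (q w))" if "w \<in> form_domain M q" for w
    using form_domain_finite[OF that] by (simp add: less_top)
  have "ennreal (enn2real (q (\<lambda>x. u x + v x)))
      \<le> ennreal (1 / (1 - (1/2)^k)) * ennreal (enn2real (q u)) + ennreal (2^k) * ennreal (enn2real (q v))"
    using quadratic_form_add_le_dyadic[OF q form_domain_measurable[OF u] form_domain_measurable[OF v] k]
    unfolding eq[OF u, symmetric] eq[OF v, symmetric] eq[OF form_domain_add[OF q u v], symmetric] .
  also have "\<dots> = ennreal (enn2real (q u) / (1 - (1/2)^k) + 2^k * enn2real (q v))"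
    using c by (simp add: ennreal_mult'[symmetric] ennreal_plus[symmetric] del: ennreal_plus)
  finally show ?thesis
    using c by (subst (asm) ennreal_le_iff) auto
qed

text \<open>This makes seminorm balls behave as open sets: a ball that contains zero without being
  centred there also contains all sufficiently small differences of a sequence.\<close>

lemma enn2real_form_perturbation:
  assumes q: "quadratic_form M q" and u: "u \<in> form_domain M q" and s: "enn2real (q u) < s"
  obtains d where "d > 0"
    "\<And>v. v \<in> form_domain M q \<Longrightarrow> enn2real (q v) < d \<Longrightarrow> enn2real (q (\<lambda>x. u x + v x)) < s"
proof -
  \<comment> \<open>The factor of \<open>q u\<close> tends to 1 as \<open>k\<close> grows, so some
    fixed \<open>k\<close> keeps that term below \<open>s\<close>.\<close>
  have "(\<lambda>k. enn2real (q u) / (1 - (1/2)^k)) \<longlonglongrightarrow> enn2real (q u) / (1 - 0)"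
    by (intro tendsto_divide tendsto_diff tendsto_const LIMSEQ_power_zero) auto
  then have "\<forall>\<^sub>F k in sequentially. enn2real (q u) / (1 - (1/2)^k) < s"
    using s by (intro order_tendstoD) auto
  then obtain k where k: "enn2real (q u) / (1 - (1/2)^k) < s" "k > 0"
    using eventually_happens'[OF sequentially_bot eventually_conj[OF _ eventually_gt_at_top[of 0]]]
    by blast
  define t where "t = enn2real (q u) / (1 - (1/2)^k)"
  show thesis
  \<comment> \<open>The remaining gap \<open>s - t\<close> has to absorb
    \<open>2^k * q v\<close>.\<close>
  proof (rule that[of "(s - t) / 2^k"])
    show "(s - t) / 2^k > 0" using k by (simp add: t_def)
    fix v assume v: "v \<in> form_domain M q" and "enn2real (q v) < (s - t) / 2^k"
    then have "2^k * enn2real (q v) < s - t" by (simp add: pos_less_divide_eq mult.commute)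
    then show "enn2real (q (\<lambda>x. u x + v x)) < s"
      using enn2real_form_add_le_dyadic[OF q u v k(2)] unfolding t_def by linarith
  qed
qed

subsection \<open>Local convergence in measure\<close>

lemma set_integrable_min_one:
  fixes f :: "'a \<Rightarrow> real"
  assumes [measurable]: "f \<in> borel_measurable M" "U \<in> sets M" and "emeasure M U < \<infinity>"
  shows "set_integrable M U (\<lambda>x. min \<bar>f x\<bar> 1)"
  unfolding set_integrable_def
proof (rule Bochner_Integration.integrable_bound)
  show "integrable M (indicator U :: 'a \<Rightarrow> real)" using assms by simp
qed (auto split: split_indicator)

text \<open>Dominated convergence with majorant \<open>indicator U\<close>, integrable because
  \<open>U\<close> has finite measure. The free \<open>g\<close> allows comparing \<open>s n\<close>
  with its a.e. limit or with another candidate limit.\<close>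

lemma set_integral_min_one_tendsto:
  fixes f g :: "'a \<Rightarrow> real"
  assumes [measurable]: "\<And>n. s n \<in> borel_measurable M" "f \<in> borel_measurable M" "g \<in> borel_measurable M"
      "U \<in> sets M" and U: "emeasure M U < \<infinity>"
    and lim: "AE x in M. (\<lambda>n. s n x) \<longlonglongrightarrow> f x"
  shows "(\<lambda>n. LINT x:U|M. min \<bar>g x - s n x\<bar> 1) \<longlonglongrightarrow> (LINT x:U|M. min \<bar>g x - f x\<bar> 1)"
  unfolding set_lebesgue_integral_def
proof (rule integral_dominated_convergence[where w = "indicator U"])
  show "integrable M (indicator U :: 'a \<Rightarrow> real)" using U by simp
  show "AE x in M. (\<lambda>n. indicator U x *\<^sub>R min \<bar>g x - s n x\<bar> 1) \<longlonglongrightarrow> indicator U x *\<^sub>R min \<bar>g x - f x\<bar> 1"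
    using lim by eventually_elim (intro tendsto_intros)
qed (auto split: split_indicator)

text \<open>Local convergence in measure separates points: the set of disagreement has no subset of
  positive finite measure, and semi-finiteness then makes it null.\<close>

lemma semi_finite_AE_eq:
  fixes f g :: "'a \<Rightarrow> real"
  assumes "semi_finite M" and [measurable]: "f \<in> borel_measurable M" "g \<in> borel_measurable M"
    and zero: "\<And>U. U \<in> sets M \<Longrightarrow> emeasure M U < \<infinity> \<Longrightarrow> (LINT x:U|M. min \<bar>f x - g x\<bar> 1) = 0"
  shows "AE x in M. f x = g x"
proof -
  let ?N = "{x \<in> space M. f x \<noteq> g x}"
  have null: "emeasure M B = 0" if [measurable]: "B \<in> sets M" and "B \<subseteq> ?N" "emeasure M B < \<infinity>" for B
  proof -
    have "integrable M (\<lambda>x. indicator B x *\<^sub>R min \<bar>f x - g x\<bar> 1)"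
      using set_integrable_min_one[of "\<lambda>x. f x - g x" M B] that unfolding set_integrable_def by simp
    moreover have "(\<integral>x. indicator B x *\<^sub>R min \<bar>f x - g x\<bar> 1 \<partial>M) = 0"
      using zero[of B] that unfolding set_lebesgue_integral_def by simp
    ultimately have "AE x in M. indicator B x *\<^sub>R min \<bar>f x - g x\<bar> 1 = 0"
      by (subst (asm) integral_nonneg_eq_0_iff_AE) (auto split: split_indicator)
    then have "AE x in M. x \<notin> B"
    proof eventually_elim
      case (elim x)
      then show ?case using \<open>B \<subseteq> ?N\<close> by (auto simp: min_def indicator_def split: if_splits)
    qed
    then have "B \<in> null_sets M" by (subst AE_iff_null_sets) auto
    then show ?thesis by auto
  qed
  \<comment> \<open>Infinite measure would yield a subset of positive finite measure, against
    \<open>null\<close>.\<close>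
  have "emeasure M ?N < \<infinity>"
  proof (rule ccontr)
    assume "\<not> ?thesis"
    then have "emeasure M ?N = \<infinity>" by (simp add: less_top[symmetric])
    moreover have "?N \<in> sets M" by measurable
    ultimately obtain B where "B \<in> sets M" "B \<subseteq> ?N" "0 < emeasure M B" "emeasure M B < \<infinity>"
      using \<open>semi_finite M\<close> unfolding semi_finite_def by blast
    then show False using null[of B] by simp
  qed
  then have "emeasure M ?N = 0" by (intro null) auto
  then show ?thesis by (subst AE_iff_measurable[of ?N]) auto
qed

subsection \<open>The form topology\<close>

lemma topspace_form_seminorm_topology:
  assumes "quadratic_form M q"
  shows "topspace (form_seminorm_topology M q) = form_domain M q"
proof -
  have "f \<in> {g \<in> form_domain M q. sqrt (enn2real (q (\<lambda>x. f x - g x))) < 1}" if "f \<in> form_domain M q" for f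
    using that quadratic_form_zero[OF assms] by simp
  then show ?thesis
    unfolding form_seminorm_topology_def topology_generated_by_topspace
    by (intro subset_antisym subsetI) (blast, blast intro: zero_less_one)
qed

lemma topspace_form_topology:
  assumes "quadratic_form M q"
  shows "topspace (form_topology M q) = form_domain M q"
proof
  show "topspace (form_topology M q) \<subseteq> form_domain M q"
    unfolding form_topology_def topology_generated_by_topspace
  proof (rule Union_least)
    fix V
    assume "V \<in> {V. openin (subtopology (local_measure_topology M) (form_domain M q)) V} \<union>
      {V. openin (form_seminorm_topology M q) V}"
    then consider "openin (subtopology (local_measure_topology M) (form_domain M q)) V"
      | "openin (form_seminorm_topology M q) V" by blast
    then show "V \<subseteq> form_domain M q"
    proof cases
      case 1
      then show ?thesis by (meson openin_imp_subset)
    next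
      case 2
      then show ?thesis using openin_subset topspace_form_seminorm_topology[OF assms] by blast
    qed
  qed
  show "form_domain M q \<subseteq> topspace (form_topology M q)"
    unfolding form_topology_def topology_generated_by_topspace
    using openin_topspace[of "form_seminorm_topology M q"] topspace_form_seminorm_topology[OF assms]
    by auto
qed

lemma openin_form_topology_ball:
  assumes "f \<in> form_domain M q" "0 < r"
  shows "openin (form_topology M q) {g \<in> form_domain M q. sqrt (enn2real (q (\<lambda>x. f x - g x))) < r}"
  unfolding form_topology_def
  by (rule topology_generated_by_Basis, rule UnI2, simp, unfold form_seminorm_topology_def,
      rule topology_generated_by_Basis) (use assms in blast)

lemma openin_form_topology_measure_ball:
  assumes "f \<in> borel_measurable M" "U \<in> sets M" "emeasure M U < \<infinity>" "0 < r"
  shows "openin (form_topology M q)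
    ({g \<in> borel_measurable M. (LINT x:U|M. min \<bar>f x - g x\<bar> 1) < r} \<inter> form_domain M q)"
  unfolding form_topology_def
  by (rule topology_generated_by_Basis, rule UnI1, simp, rule openin_subtopology_Int,
      unfold local_measure_topology_def, rule topology_generated_by_Basis) (use assms in blast)

text \<open>Convergence to \<open>z\<close> need only be tested on generating sets around
  \<open>z\<close>: eventual membership passes to finite intersections and to unions.\<close>

lemma openin_generated_eventually:
  assumes "openin (topology_generated_by \<S>) N" "z \<in> N"
    and "\<And>B. B \<in> \<S> \<Longrightarrow> z \<in> B \<Longrightarrow> eventually (\<lambda>i. h i \<in> B) F"
  shows "eventually (\<lambda>i. h i \<in> N) F"
proof -
  have "generate_topology_on \<S> N" using assms(1) by (simp add: openin_topology_generated_by_iff)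
  then show ?thesis using assms(2)
  proof induction
    case (UN K)
    then obtain k where "k \<in> K" "z \<in> k" by blast
    with UN.IH[of k] show ?case by (auto elim: eventually_mono)
  qed (auto simp: assms(3) intro: eventually_conj)
qed

text \<open>The claim reduces to convergence of the differences \<open>s i - s j\<close> to zero
  along the product filter. On generators, a.e. convergence handles the measure balls and the last
  hypothesis the seminorm balls.\<close>

lemma Cauchy_filter_form_topology:
  assumes q: "quadratic_form M q" and s: "\<And>n. s n \<in> form_domain M q"
    and f [measurable]: "f \<in> borel_measurable M" and lim: "AE x in M. (\<lambda>n. s n x) \<longlonglongrightarrow> f x"
    and Cauchy: "\<And>e. 0 < e \<Longrightarrow>
      \<forall>\<^sub>F p in sequentially \<times>\<^sub>F sequentially. enn2real (q (\<lambda>x. s (fst p) x - s (snd p) x)) < e"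
  shows "Cauchy_filter (form_topology M q) (filtermap s sequentially)"
  unfolding Cauchy_filter_def
proof (intro conjI allI impI)
  show "filtermap s sequentially \<noteq> bot" by (simp add: filtermap_bot_iff)
  show "\<forall>\<^sub>F g in filtermap s sequentially. g \<in> topspace (form_topology M q)"
    by (simp add: eventually_filtermap topspace_form_topology[OF q] s)
  fix N assume N: "openin (form_topology M q) N \<and> (\<lambda>_. 0) \<in> N"
  let ?F = "sequentially \<times>\<^sub>F sequentially :: (nat \<times> nat) filter"
  let ?d = "\<lambda>p::nat \<times> nat. \<lambda>x. s (fst p) x - s (snd p) x"
  have [measurable]: "s n \<in> borel_measurable M" for n using form_domain_measurable[OF s] .
  have d: "?d p \<in> form_domain M q" for p by (intro form_domain_diff q s)
  \<comment> \<open>The ball is centred at \<open>h\<close>, not necessarily at zero; its slack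
    \<open>r - J\<close> at zero is split evenly between the two difference terms.\<close>
  have measure_ball: "\<forall>\<^sub>F p in ?F. ?d p \<in> B"
    if B: "B \<in> {{g \<in> borel_measurable M. (LINT x:U|M. min \<bar>h x - g x\<bar> 1) < r} | h U r.
      h \<in> borel_measurable M \<and> U \<in> sets M \<and> emeasure M U < \<infinity> \<and> 0 < r}" and z: "(\<lambda>_. 0) \<in> B" for B
  proof -
    from B obtain h U r where B_eq: "B = {g \<in> borel_measurable M. (LINT x:U|M. min \<bar>h x - g x\<bar> 1) < r}"
      and [measurable]: "h \<in> borel_measurable M" "U \<in> sets M" and U: "emeasure M U < \<infinity>" by blast
    define I where "I n = (LINT x:U|M. min \<bar>f x - s n x\<bar> 1)" for n
    define J where "J = (LINT x:U|M. min \<bar>h x\<bar> 1)"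
    have J: "J < r" using z by (simp add: B_eq J_def)
    have "I \<longlonglongrightarrow> (LINT x:U|M. min \<bar>f x - f x\<bar> 1)"
      unfolding I_def by (rule set_integral_min_one_tendsto) (use U lim in auto)
    then have "I \<longlonglongrightarrow> 0" by simp
    then have ev: "\<forall>\<^sub>F n in sequentially. I n < (r - J) / 2"
      using J by (intro order_tendstoD) auto
    have "\<forall>\<^sub>F p in ?F. I (fst p) < (r - J) / 2 \<and> I (snd p) < (r - J) / 2"
      using eventually_prodI[OF ev ev] by simp
    then show ?thesis
    proof eventually_elim
      case (elim p)
      \<comment> \<open>Subadditivity of \<open>min \<bar>t\<bar> 1\<close> in \<open>t\<close>,
        applied to \<open>h - (s i - s j) = h + (f - s i) - (f - s j)\<close>.\<close>
      have "(LINT x:U|M. min \<bar>h x - ?d p x\<bar> 1)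
          \<le> (LINT x:U|M. min \<bar>h x\<bar> 1 + (min \<bar>f x - s (fst p) x\<bar> 1 + min \<bar>f x - s (snd p) x\<bar> 1))"
        by (rule set_integral_mono) (use U in \<open>auto intro!: set_integrable_min_one set_integral_add\<close>)
      also have "\<dots> = J + (I (fst p) + I (snd p))"
        unfolding J_def I_def
        by (subst set_integral_add, (use U in \<open>auto intro!: set_integrable_min_one set_integral_add(1)\<close>)[2])+
           (rule refl)
      finally show ?case using elim J by (auto simp: B_eq)
    qed
  qed
  have seminorm_ball: "\<forall>\<^sub>F p in ?F. ?d p \<in> B"
    if B: "B \<in> {{g \<in> form_domain M q. sqrt (enn2real (q (\<lambda>x. h x - g x))) < r} | h r.
      h \<in> form_domain M q \<and> 0 < r}" and z: "(\<lambda>_. 0) \<in> B" for B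
  proof -
    from B obtain h r where B_eq: "B = {g \<in> form_domain M q. sqrt (enn2real (q (\<lambda>x. h x - g x))) < r}"
      and h: "h \<in> form_domain M q" and r: "0 < r" by blast
    have lt_iff: "sqrt t < r \<longleftrightarrow> t < r\<^sup>2" for t
      using r by (metis less_eq_real_def real_sqrt_abs real_sqrt_less_iff abs_of_nonneg)
    \<comment> \<open>Zero lies in the ball around \<open>h\<close>, so the strict inequality leaves
      room for a perturbation.\<close>
    have "enn2real (q h) < r\<^sup>2" using z by (simp add: B_eq lt_iff)
    then obtain e where e: "e > 0"
      "\<And>v. v \<in> form_domain M q \<Longrightarrow> enn2real (q v) < e \<Longrightarrow> enn2real (q (\<lambda>x. h x + v x)) < r\<^sup>2"
      using enn2real_form_perturbation[OF q h] by blast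
    show ?thesis using Cauchy[OF e(1)]
    proof eventually_elim
      case (elim p)
      have "enn2real (q (\<lambda>x. h x + (s (snd p) x - s (fst p) x))) < r\<^sup>2"
        using elim by (intro e(2) form_domain_diff q s)
          (simp add: quadratic_form_diff_commute[OF q, of "s (fst p)" "s (snd p)"])
      then show ?case using d[of p] by (simp add: B_eq lt_iff algebra_simps)
    qed
  qed
  \<comment> \<open>The generators of the form topology are open sets of two topologies that are
    themselves generated, so the subbasis criterion is applied twice.\<close>
  have "\<forall>\<^sub>F p in ?F. ?d p \<in> N"
  proof (rule openin_generated_eventually)
    show "openin (topology_generated_by
        ({V. openin (subtopology (local_measure_topology M) (form_domain M q)) V} \<union>
         {V. openin (form_seminorm_topology M q) V})) N"
      using N by (simp add: form_topology_def)
    show "(\<lambda>_. 0) \<in> N" using N by simp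
    fix B assume z: "(\<lambda>_. 0::real) \<in> B"
      and "B \<in> {V. openin (subtopology (local_measure_topology M) (form_domain M q)) V} \<union>
         {V. openin (form_seminorm_topology M q) V}"
    then consider T where "openin (local_measure_topology M) T" "B = T \<inter> form_domain M q"
      | "openin (form_seminorm_topology M q) B"
      by (auto simp: openin_subtopology)
    then show "\<forall>\<^sub>F p in ?F. ?d p \<in> B"
    proof cases
      case 1
      have "\<forall>\<^sub>F p in ?F. ?d p \<in> T"
        by (rule openin_generated_eventually[OF 1(1)[unfolded local_measure_topology_def]])
           (use z 1(2) measure_ball in auto)
      then show ?thesis using d by (auto simp: 1(2) elim: eventually_mono)
    next
      case 2
      show ?thesis
        by (rule openin_generated_eventually[OF 2[unfolded form_seminorm_topology_def] z seminorm_ball])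
    qed
  qed
  then obtain n where n: "\<And>i j. n \<le> i \<Longrightarrow> n \<le> j \<Longrightarrow> ?d (i, j) \<in> N"
    unfolding eventually_prod_sequentially by auto
  show "\<exists>A. (\<forall>\<^sub>F g in filtermap s sequentially. g \<in> A) \<and> (\<forall>f\<in>A. \<forall>g\<in>A. (\<lambda>x. f x - g x) \<in> N)"
  proof (intro exI[of _ "s ` {n..}"] conjI)
    show "\<forall>\<^sub>F g in filtermap s sequentially. g \<in> s ` {n..}"
      unfolding eventually_filtermap using eventually_ge_at_top[of n] by eventually_elim auto
  qed (use n in auto)
qed

text \<open>Completeness yields some form limit \<open>h\<close>, which is also a limit in local
  measure and hence equals \<open>f\<close> a.e.; the seminorm part of the topology then gives the
  convergence in \<open>q\<close>.\<close>

lemma closed_form_limit: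
  assumes "semi_finite M" and closed: "closed_form M q" and s: "\<And>n. s n \<in> form_domain M q"
    and f [measurable]: "f \<in> borel_measurable M" and lim: "AE x in M. (\<lambda>n. s n x) \<longlonglongrightarrow> f x"
    and Cauchy: "\<And>e. 0 < e \<Longrightarrow>
      \<forall>\<^sub>F p in sequentially \<times>\<^sub>F sequentially. enn2real (q (\<lambda>x. s (fst p) x - s (snd p) x)) < e"
  shows "f \<in> form_domain M q" "(\<lambda>n. enn2real (q (\<lambda>x. f x - s n x))) \<longlonglongrightarrow> 0"
proof -
  have q: "quadratic_form M q" and complete: "complete_topology (form_topology M q)"
    using closed by (auto simp: closed_form_def)
  obtain h where h: "limitin (form_topology M q) (\<lambda>g. g) h (filtermap s sequentially)"
    using complete Cauchy_filter_form_topology[OF q s f lim Cauchy] unfolding complete_topology_def by blast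
  have hD: "h \<in> form_domain M q" using h by (simp add: limitin_def topspace_form_topology[OF q])
  have ev: "\<forall>\<^sub>F n in sequentially. s n \<in> V" if "openin (form_topology M q) V" "h \<in> V" for V
    using h that by (auto simp: limitin_def eventually_filtermap)
  have [measurable]: "s n \<in> borel_measurable M" "h \<in> borel_measurable M" for n
    using form_domain_measurable[OF s] form_domain_measurable[OF hD] .
  have "AE x in M. h x = f x"
  proof (rule semi_finite_AE_eq)
    fix U assume [measurable]: "U \<in> sets M" and U: "emeasure M U < \<infinity>"
    have "(\<lambda>n. LINT x:U|M. min \<bar>h x - s n x\<bar> 1) \<longlonglongrightarrow> (LINT x:U|M. min \<bar>h x - f x\<bar> 1)"
      by (rule set_integral_min_one_tendsto) (use U lim in auto)
    \<comment> \<open>Measure balls around \<open>h\<close> are open in the form topology, so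
      \<open>s n\<close> eventually enters each of them.\<close>
    moreover have "(\<lambda>n. LINT x:U|M. min \<bar>h x - s n x\<bar> 1) \<longlonglongrightarrow> 0"
    proof (rule order_tendstoI)
      fix r :: real assume "0 < r"
      have "\<forall>\<^sub>F n in sequentially.
          s n \<in> {g \<in> borel_measurable M. (LINT x:U|M. min \<bar>h x - g x\<bar> 1) < r} \<inter> form_domain M q"
        by (rule ev, rule openin_form_topology_measure_ball) (use U hD \<open>0 < r\<close> in auto)
      then show "\<forall>\<^sub>F n in sequentially. (LINT x:U|M. min \<bar>h x - s n x\<bar> 1) < r"
        by eventually_elim auto
    next
      fix r :: real assume "r < 0"
      moreover have "0 \<le> (LINT x:U|M. min \<bar>h x - s n x\<bar> 1)" for n
        unfolding set_lebesgue_integral_def by (intro integral_nonneg_AE) auto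
      ultimately show "\<forall>\<^sub>F n in sequentially. r < (LINT x:U|M. min \<bar>h x - s n x\<bar> 1)"
        by (intro always_eventually allI) (meson less_le_trans)
    qed
    ultimately show "(LINT x:U|M. min \<bar>h x - f x\<bar> 1) = 0" by (rule LIMSEQ_unique)
  qed (use \<open>semi_finite M\<close> in auto)
  note ae = this
  have "q f = q h" using ae by (intro quadratic_form_cong_AE[OF q]) auto
  then show "f \<in> form_domain M q" using form_domain_finite[OF hD] by (intro form_domainI) auto
  have eq: "q (\<lambda>x. f x - s n x) = q (\<lambda>x. h x - s n x)" for n
    using ae by (intro quadratic_form_cong_AE[OF q]) auto
  have "(\<lambda>n. sqrt (enn2real (q (\<lambda>x. h x - s n x)))) \<longlonglongrightarrow> 0"
  proof (rule order_tendstoI)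
    fix r :: real assume "0 < r"
    have "\<forall>\<^sub>F n in sequentially. s n \<in> {g \<in> form_domain M q. sqrt (enn2real (q (\<lambda>x. h x - g x))) < r}"
      by (rule ev, rule openin_form_topology_ball)
         (use hD \<open>0 < r\<close> quadratic_form_zero[OF q] in auto)
    then show "\<forall>\<^sub>F n in sequentially. sqrt (enn2real (q (\<lambda>x. h x - s n x))) < r"
      by eventually_elim auto
  next
    fix r :: real assume "r < 0"
    then show "\<forall>\<^sub>F n in sequentially. r < sqrt (enn2real (q (\<lambda>x. h x - s n x)))"
      by (intro always_eventually allI) (meson less_le_trans real_sqrt_ge_zero enn2real_nonneg)
  qed
  from tendsto_power[OF this, of 2] show "(\<lambda>n. enn2real (q (\<lambda>x. f x - s n x))) \<longlonglongrightarrow> 0"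
    by (simp add: eq)
qed


subsection \<open>Lower semicontinuity\<close>

text \<open>A stand-in for the convex hull: the parallelogram law only needs closure under
  midpoints.\<close>

inductive_set midpoint_hull :: "('a \<Rightarrow> real) set \<Rightarrow> ('a \<Rightarrow> real) set" for S where
  base: "u \<in> S \<Longrightarrow> u \<in> midpoint_hull S"
| midpoint: "u \<in> midpoint_hull S \<Longrightarrow> v \<in> midpoint_hull S \<Longrightarrow> (\<lambda>x. (u x + v x) / 2) \<in> midpoint_hull S"

lemma midpoint_hull_mono: "S \<subseteq> T \<Longrightarrow> midpoint_hull S \<subseteq> midpoint_hull T"
proof
  fix u assume "S \<subseteq> T" "u \<in> midpoint_hull S"
  from this(2,1) show "u \<in> midpoint_hull T"
    by induction (auto intro: midpoint_hull.intros)
qed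

lemma midpoint_hull_measurable:
  assumes "S \<subseteq> borel_measurable M" "u \<in> midpoint_hull S"
  shows "u \<in> borel_measurable M"
  using assms(2) by induction (use assms(1) in auto)

lemma midpoint_hull_form_le:
  assumes q: "quadratic_form M q" and S: "S \<subseteq> borel_measurable M" "\<And>u. u \<in> S \<Longrightarrow> q u \<le> B"
    and "u \<in> midpoint_hull S"
  shows "q u \<le> B"
  using assms(4)
proof induction
  case (midpoint u v)
  then show ?case
    by (intro quadratic_form_midpoint_le[OF q] midpoint_hull_measurable[OF S(1)])
qed (rule S(2))

text \<open>Open intervals are closed under midpoints. Hence any selection from the hulls of the
  tails keeps the pointwise limit.\<close>

lemma midpoint_hull_pointwise_close:
  assumes "\<And>u. u \<in> S \<Longrightarrow> \<bar>u x - a\<bar> < e" "u \<in> midpoint_hull S"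
  shows "\<bar>u x - a\<bar> < e"
  using assms(2)
proof induction
  case (midpoint u v)
  then show ?case unfolding abs_less_iff by (simp add: field_simps)
qed (rule assms(1))

text \<open>Solved in the reals for the difference and phrased with the midpoint, so that a lower
  bound for \<open>q\<close> at midpoints bounds differences from above.\<close>

lemma enn2real_form_parallelogram:
  assumes q: "quadratic_form M q" and u: "u \<in> form_domain M q" and v: "v \<in> form_domain M q"
  shows "enn2real (q (\<lambda>x. u x - v x)) =
    2 * enn2real (q u) + 2 * enn2real (q v) - 4 * enn2real (q (\<lambda>x. (u x + v x) / 2))"
proof -
  have m [measurable]: "u \<in> borel_measurable M" "v \<in> borel_measurable M"
    using u v by (simp_all add: form_domain_def)
  define w where "w = (\<lambda>x. (u x + v x) / 2)"
  have w: "w \<in> form_domain M q"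
    using form_domain_scale[OF q form_domain_add[OF q u v], of "1/2"] unfolding w_def by simp
  have [measurable]: "w \<in> borel_measurable M" using w by (simp add: form_domain_def)
  have "(\<lambda>x. u x + v x) = (\<lambda>x. 2 * w x)" by (auto simp: w_def add_divide_distrib)
  then have add: "q (\<lambda>x. u x + v x) = ennreal (2\<^sup>2) * q w"
    using quadratic_form_scale[OF q, of w 2] by simp
  have diff: "(\<lambda>x. u x - v x) \<in> form_domain M q" by (rule form_domain_diff[OF q u v])
  have eq: "ennreal (enn2real (q h)) = q h" if "h \<in> form_domain M q" for h
    using form_domain_finite[OF that] by simp
  have "2 * q u + 2 * q v = ennreal (2\<^sup>2) * q w + q (\<lambda>x. u x - v x)"
    using quadratic_form_parallelogram[OF q m] add by simp
  then have "ennreal 2 * ennreal (enn2real (q u)) + ennreal 2 * ennreal (enn2real (q v))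
    = ennreal 4 * ennreal (enn2real (q w)) + ennreal (enn2real (q (\<lambda>x. u x - v x)))"
    unfolding eq[OF u] eq[OF v] eq[OF w] eq[OF diff] by simp
  then have "ennreal (2 * enn2real (q u) + 2 * enn2real (q v))
    = ennreal (4 * enn2real (q w) + enn2real (q (\<lambda>x. u x - v x)))"
    by (simp only: ennreal_mult'[symmetric] ennreal_plus mult_nonneg_nonneg enn2real_nonneg
        zero_le_numeral)
  then have "2 * enn2real (q u) + 2 * enn2real (q v) = 4 * enn2real (q w) + enn2real (q (\<lambda>x. u x - v x))"
    by (subst (asm) ennreal_inj) auto
  then show ?thesis unfolding w_def by simp
qed

text \<open>
  The infima of \<open>q\<close> over the midpoint hulls of the tails increase to a limit, so by the
  parallelogram law near-minimizers form a Cauchy sequence for \<open>q\<^sup>1\<^sup>/\<^sup>2\<close>; they still converge to \<open>f\<close>.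
\<close>

lemma closed_form_Fatou:
  assumes "semi_finite M" and closed: "closed_form M q"
    and s: "\<And>n. s n \<in> borel_measurable M" and f [measurable]: "f \<in> borel_measurable M"
    and lim: "AE x in M. (\<lambda>n. s n x) \<longlonglongrightarrow> f x" and le: "\<And>n. q (s n) \<le> B"
  shows "q f \<le> B"
proof (cases "B = \<infinity>")
  case False
  then obtain c where c: "B = ennreal c" "0 \<le> c" by (cases B) auto
  have q: "quadratic_form M q" using closed by (simp add: closed_form_def)
  define Q where "Q u = enn2real (q u)" for u
  define K where "K n = midpoint_hull (s ` {n..})" for n
  have K_D: "u \<in> form_domain M q" and K_le: "Q u \<le> c" if "u \<in> K n" for u n
  proof -
    have "u \<in> borel_measurable M"
      by (rule midpoint_hull_measurable[of "s ` {n..}"]) (use s that in \<open>auto simp: K_def\<close>)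
    moreover have "q u \<le> B"
      by (rule midpoint_hull_form_le[OF q, of "s ` {n..}"]) (use s le that in \<open>auto simp: K_def\<close>)
    ultimately show "u \<in> form_domain M q" "Q u \<le> c"
      using c by (auto simp: Q_def intro!: form_domainI enn2real_leI order_le_less_trans[of "q u" B])
  qed
  have K_mono: "K m \<subseteq> K n" if "n \<le> m" for n m
    unfolding K_def by (rule midpoint_hull_mono) (use that in auto)
  define d where "d n = Inf (Q ` K n)" for n
  have K_ne: "s n \<in> K n" for n by (auto simp: K_def intro: midpoint_hull.base)
  have bdd: "bdd_below (Q ` K n)" for n
    by (rule bdd_belowI[of _ 0]) (auto simp: Q_def)
  have d_le: "d n \<le> Q u" if "u \<in> K n" for u n
    unfolding d_def by (rule cInf_lower) (use bdd that in auto)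
  have "incseq d"
  proof (rule incseq_SucI)
    fix n show "d n \<le> d (Suc n)"
      unfolding d_def by (rule cInf_superset_mono) (use K_ne bdd K_mono[of n "Suc n"] in auto)
  qed
  moreover have "d n \<le> c" for n using d_le[OF K_ne] K_le[OF K_ne] by (rule order_trans)
  ultimately obtain L where L: "d \<longlonglongrightarrow> L" "\<And>n. d n \<le> L"
    using incseq_convergent[of d c] by blast
  have "\<exists>u\<in>K n. Q u < d n + 1 / Suc n" for n
    using cInf_lessD[of "Q ` K n" "d n + 1 / Suc n"] K_ne[of n] unfolding d_def by fastforce
  then obtain g where g: "\<And>n. g n \<in> K n" "\<And>n. Q (g n) < d n + 1 / Suc n" by metis
  have gD: "g n \<in> form_domain M q" for n using K_D g(1) .
  have [measurable]: "g n \<in> borel_measurable M" for n using form_domain_measurable[OF gD] .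
  \<comment> \<open>For \<open>n \<le> m\<close> the midpoint of \<open>g n\<close> and
    \<open>g m\<close> lies in \<open>K n\<close> and has value at least \<open>d n\<close>. The
    parallelogram law then bounds the difference by
    \<open>2 * (d m - d n) + 2 / Suc n + 2 / Suc m\<close>, and \<open>d m \<le> L\<close>.\<close>
  define e where "e n = 2 * (L - d n) + 4 * (1 / Suc n)" for n
  have e_nonneg: "0 \<le> e n" for n using L(2)[of n] unfolding e_def by simp
  have e_lim: "e \<longlonglongrightarrow> 0"
  proof -
    have "e \<longlonglongrightarrow> 2 * (L - L) + 4 * 0"
      unfolding e_def using LIMSEQ_inverse_real_of_nat
      by (intro tendsto_add tendsto_mult tendsto_diff tendsto_const L(1)) (simp add: inverse_eq_divide)
    then show ?thesis by simp
  qed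
  have Q_ordered: "Q (\<lambda>x. g n x - g m x) \<le> e n" if "n \<le> m" for n m
  proof -
    have "(\<lambda>x. (g n x + g m x) / 2) \<in> K n"
      unfolding K_def using g(1)[of n] g(1)[of m] K_mono[OF that]
      by (intro midpoint_hull.midpoint) (auto simp: K_def)
    then have "d n \<le> Q (\<lambda>x. (g n x + g m x) / 2)" by (rule d_le)
    moreover have "Q (\<lambda>x. g n x - g m x) = 2 * Q (g n) + 2 * Q (g m) - 4 * Q (\<lambda>x. (g n x + g m x) / 2)"
      unfolding Q_def by (rule enn2real_form_parallelogram[OF q gD gD])
    moreover have "1 / real (Suc m) \<le> 1 / real (Suc n)" using that by (simp add: frac_le)
    ultimately show ?thesis
      using g(2)[of n] g(2)[of m] L(2)[of m] unfolding e_def by argo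
  qed
  \<comment> \<open>Symmetry of \<open>q\<close> and the other nonnegative error remove the
    condition on the order of the indices.\<close>
  have Q_diff: "Q (\<lambda>x. g n x - g m x) \<le> e n + e m" for n m
  proof (cases "n \<le> m")
    case True
    then show ?thesis using Q_ordered[OF True] e_nonneg[of m] by linarith
  next
    case False
    have "Q (\<lambda>x. g n x - g m x) = Q (\<lambda>x. g m x - g n x)"
      unfolding Q_def by (subst quadratic_form_diff_commute[OF q]) auto
    then show ?thesis using Q_ordered[of m n] False e_nonneg[of n] by linarith
  qed
  have g_lim: "AE x in M. (\<lambda>n. g n x) \<longlonglongrightarrow> f x"
    using lim
  proof eventually_elim
    case (elim x)
    show ?case
    proof (rule LIMSEQ_I)
      fix r :: real assume "0 < r"
      then obtain N where N: "\<And>n. n \<ge> N \<Longrightarrow> \<bar>s n x - f x\<bar> < r"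
        using LIMSEQ_D[OF elim] by (auto simp: real_norm_def)
      have "\<bar>g n x - f x\<bar> < r" if "n \<ge> N" for n
        by (rule midpoint_hull_pointwise_close[of "s ` {n..}"])
           (use N that g(1)[of n] in \<open>auto simp: K_def\<close>)
      then show "\<exists>N. \<forall>n\<ge>N. norm (g n x - f x) < r" by auto
    qed
  qed
  have Cauchy: "\<forall>\<^sub>F p in sequentially \<times>\<^sub>F sequentially. enn2real (q (\<lambda>x. g (fst p) x - g (snd p) x)) < r"
    if "0 < r" for r
  proof -
    have ev: "\<forall>\<^sub>F n in sequentially. e n < r / 2" using e_lim that by (intro order_tendstoD) auto
    have "\<forall>\<^sub>F p in sequentially \<times>\<^sub>F sequentially. e (fst p) < r / 2 \<and> e (snd p) < r / 2"
      using eventually_prodI[OF ev ev] by simp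
    then show ?thesis
    proof eventually_elim
      case (elim p)
      then show ?case using Q_diff[of "fst p" "snd p"] unfolding Q_def by linarith
    qed
  qed
  note limit = closed_form_limit[OF \<open>semi_finite M\<close> closed gD f g_lim Cauchy]
  \<comment> \<open>Write \<open>f = g n + (f - g n)\<close> and let \<open>n\<close> tend to
    infinity with \<open>k\<close> fixed; only afterwards does \<open>k\<close> grow, to remove the
    factor.\<close>
  have Q_f: "Q f \<le> c / (1 - (1/2)^k)" if "k > 0" for k
  proof (rule LIMSEQ_le_const)
    show "(\<lambda>n. c / (1 - (1/2)^k) + 2^k * enn2real (q (\<lambda>x. f x - g n x))) \<longlonglongrightarrow> c / (1 - (1/2)^k)"
      using tendsto_add[OF tendsto_const tendsto_mult[OF tendsto_const limit(2)],
          of "c / (1 - (1/2)^k)" "2^k"] by simp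
    have pos: "1 - (1/2)^k > (0::real)" using that power_Suc_less_one[of "1/2::real" "k - 1"] by simp
    show "\<exists>N. \<forall>n\<ge>N. Q f \<le> c / (1 - (1/2)^k) + 2^k * enn2real (q (\<lambda>x. f x - g n x))"
    proof (intro exI allI impI)
      fix n
      have "Q (\<lambda>x. g n x + (f x - g n x)) \<le> Q (g n) / (1 - (1/2)^k) + 2^k * Q (\<lambda>x. f x - g n x)"
        unfolding Q_def
        by (rule enn2real_form_add_le_dyadic[OF q gD form_domain_diff[OF q limit(1) gD] that])
      moreover have "(\<lambda>x. g n x + (f x - g n x)) = f" by simp
      moreover have "Q (g n) / (1 - (1/2)^k) \<le> c / (1 - (1/2)^k)"
        using K_le[OF g(1)] pos by (intro divide_right_mono) auto
      ultimately show "Q f \<le> c / (1 - (1/2)^k) + 2^k * enn2real (q (\<lambda>x. f x - g n x))"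
        unfolding Q_def by (simp only:)
    qed
  qed
  have "Q f \<le> c"
  proof (rule LIMSEQ_le_const)
    have "(\<lambda>k. c / (1 - (1/2)^k)) \<longlonglongrightarrow> c / (1 - 0)"
      by (intro tendsto_divide tendsto_diff tendsto_const LIMSEQ_power_zero) auto
    then show "(\<lambda>k. c / (1 - (1/2)^k)) \<longlonglongrightarrow> c" by simp
    show "\<exists>N. \<forall>k\<ge>N. Q f \<le> c / (1 - (1/2)^k)" using Q_f by (intro exI[of _ 1]) auto
  qed
  moreover have "q f = ennreal (Q f)" using form_domain_finite[OF limit(1)] by (simp add: Q_def)
  ultimately show ?thesis using c by (simp add: ennreal_leI)
qed simp


subsection \<open>Energy forms\<close>

lemma ess_boundedI: "f \<in> borel_measurable M \<Longrightarrow> AE x in M. \<bar>f x\<bar> \<le> c \<Longrightarrow> f \<in> ess_bounded M"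
  unfolding ess_bounded_def by blast

text \<open>\<open>C 0 = 0\<close> and monotonicity confine the value to
  \<open>[-\<epsilon>, 0]\<close>.\<close>

lemma cutoff_nonpos:
  assumes "cutoff \<epsilon> C" "t \<le> 0"
  shows "\<bar>C t\<bar> \<le> \<epsilon>"
proof -
  have "C t \<le> C 0" using assms unfolding cutoff_def mono_def by blast
  moreover have "C 0 = 0" using assms unfolding cutoff_def by auto
  moreover have "C t \<in> {- \<epsilon>..1 + \<epsilon>}" using assms unfolding cutoff_def by blast
  ultimately show ?thesis by auto
qed

lemma cutoff_abs_le:
  assumes "cutoff \<epsilon> C"
  shows "\<bar>C t\<bar> \<le> 1 + \<epsilon>"
proof -
  have "C t \<in> {- \<epsilon>..1 + \<epsilon>}" using assms unfolding cutoff_def by blast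
  then show ?thesis by auto
qed

text \<open>
  The approximants are \<open>n C(f / n)\<close> with an \<open>\<epsilon>\<close>-cutoff \<open>C\<close> for \<open>\<epsilon> = 1 / n\<^sup>2\<close>, which are within
  \<open>1 / n\<close> of the positive part where \<open>f \<le> n\<close>.
\<close>

lemma Markovian_bounded_approximation:
  assumes q: "quadratic_form M q" and Markov: "Markovian M q" and f [measurable]: "f \<in> borel_measurable M"
  obtains p where "\<And>n. p n \<in> ess_bounded M" "\<And>n. q (p n) \<le> q f"
    "\<And>x. (\<lambda>n. p n x) \<longlonglongrightarrow> max (f x) 0"
proof -
  \<comment> \<open>The shift by one keeps every scale positive.\<close>
  define r :: "nat \<Rightarrow> real" where "r n = real (Suc n)" for n
  have r: "r n > 0" for n by (simp add: r_def)
  have "\<exists>C. cutoff (1 / (r n)\<^sup>2) C \<and> (\<forall>f\<in>borel_measurable M. q (C \<circ> f) \<le> q f)" for n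
    using Markov r[of n] unfolding Markovian_def by simp
  then obtain C where C: "\<And>n. cutoff (1 / (r n)\<^sup>2) (C n)"
    and C_le: "\<And>n g. g \<in> borel_measurable M \<Longrightarrow> q (C n \<circ> g) \<le> q g"
    by metis
  define p where "p n x = r n * C n (f x / r n)" for n x
  have [measurable]: "C n \<in> borel_measurable borel" for n
    using C[of n] by (intro borel_measurable_mono) (simp add: cutoff_def)
  have scaled: "(C n \<circ> (\<lambda>x. 1 / r n * f x)) \<in> borel_measurable M" for n
    unfolding comp_def by measurable
  show thesis
  proof
    fix n
    show "p n \<in> ess_bounded M"
    proof (rule ess_boundedI)
      show "p n \<in> borel_measurable M" unfolding p_def by measurable
      have "\<bar>p n x\<bar> \<le> r n * (1 + 1 / (r n)\<^sup>2)" for x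
        unfolding p_def abs_mult using r[of n] cutoff_abs_le[OF C, of n]
        by (intro mult_mono) auto
      then show "AE x in M. \<bar>p n x\<bar> \<le> r n * (1 + 1 / (r n)\<^sup>2)" by simp
    qed
    have "p n = (\<lambda>x. r n * (C n \<circ> (\<lambda>x. 1 / r n * f x)) x)" by (auto simp: p_def)
    then have "q (p n) = ennreal ((r n)\<^sup>2) * q (C n \<circ> (\<lambda>x. 1 / r n * f x))"
      using quadratic_form_scale[OF q scaled, of "r n" n] by simp
    also have "\<dots> \<le> ennreal ((r n)\<^sup>2) * q (\<lambda>x. 1 / r n * f x)"
      by (intro mult_left_mono C_le) auto
    \<comment> \<open>The inner and outer scalings contribute reciprocal squares, so the bound is
      independent of \<open>n\<close>.\<close>
    also have "\<dots> = ennreal ((r n)\<^sup>2 * (1 / r n)\<^sup>2) * q f"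
      by (simp only: quadratic_form_scale[OF q f] ennreal_mult' zero_le_power2 mult.assoc)
    also have "(r n)\<^sup>2 * (1 / r n)\<^sup>2 = 1" using r[of n] by (simp add: power_divide)
    finally show "q (p n) \<le> q f" by simp
  next
    fix x
    obtain N :: nat where N: "f x \<le> N" using real_arch_simple by blast
    \<comment> \<open>Where \<open>f x \<le> 0\<close> the error is at most
      \<open>r n * (1 / (r n)^2)\<close>; elsewhere \<open>f x / r n\<close> lies in
      \<open>[0, 1]\<close>, where the cutoff is the identity.\<close>
    have close: "norm (p n x - max (f x) 0) \<le> 1 / r n" if "n \<ge> N" for n
    proof (cases "f x \<le> 0")
      case True
      then have "\<bar>p n x\<bar> \<le> r n * (1 / (r n)\<^sup>2)"
        unfolding p_def abs_mult using r[of n] cutoff_nonpos[OF C, of "f x / r n" n]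
        by (intro mult_mono) (auto simp: divide_le_0_iff)
      then show ?thesis using True r[of n] by (simp add: power2_eq_square max_def)
    next
      case False
      then have "f x / r n \<in> {0..1}" using N that r[of n] by (auto simp: r_def)
      then have "C n (f x / r n) = f x / r n" using C[of n] unfolding cutoff_def by blast
      then show ?thesis using False r[of n] by (simp add: p_def)
    qed
    have "(\<lambda>n. 1 / r n) \<longlonglongrightarrow> 0"
      using LIMSEQ_inverse_real_of_nat by (simp add: r_def inverse_eq_divide)
    then have "(\<lambda>n. p n x - max (f x) 0) \<longlonglongrightarrow> 0"
      by (rule Lim_null_comparison[rotated]) (use close eventually_sequentially in blast)
    then show "(\<lambda>n. p n x) \<longlonglongrightarrow> max (f x) 0" by (simp add: LIM_zero_iff)
  qed
qed

text \<open>Lower semicontinuity turns the approximate truncations by cutoffs into an exact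
  contraction property.\<close>

lemma energy_form_pos_part_le:
  assumes "semi_finite M" "energy_form M E" and f [measurable]: "f \<in> borel_measurable M"
  shows "E (\<lambda>x. max (f x) 0) \<le> E f"
proof -
  have closed: "closed_form M E" and Markov: "Markovian M E" and q: "quadratic_form M E"
    using assms(2) by (simp_all add: energy_form_def closed_form_def)
  obtain p where p: "\<And>n. p n \<in> ess_bounded M" "\<And>n. E (p n) \<le> E f"
    "\<And>x. (\<lambda>n. p n x) \<longlonglongrightarrow> max (f x) 0"
    using Markovian_bounded_approximation[OF q Markov f] by blast
  show ?thesis
    by (rule closed_form_Fatou[OF assms(1) closed, of p]) (use p in \<open>auto simp: ess_bounded_def\<close>)
qed

section \<open>Squares and products of bounded functions in the form domain\<close>

text \<open>
  A discretization of \<open>y\<^sup>2 = 2 \<integral>\<^sub>0\<^sup>\<infinity> (y - a)\<^sup>+ da\<close>, by which squares are limits of averages of the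
  contractions \<open>(f - a)\<^sup>+\<close>.
\<close>

lemma square_Riemann_sum_bounds:
  fixes y h :: real
  assumes "0 \<le> h" "0 \<le> y" "y \<le> real n * h"
  shows "y\<^sup>2 \<le> 2 * h * (\<Sum>k<n. max (y - real k * h) 0)"
    and "2 * h * (\<Sum>k<n. max (y - real k * h) 0) \<le> y\<^sup>2 + 2 * h * y"
proof -
  have "y\<^sup>2 \<le> 2 * h * (\<Sum>k<n. max (y - real k * h) 0) \<and>
    2 * h * (\<Sum>k<n. max (y - real k * h) 0) \<le> y\<^sup>2 + 2 * h * y"
    using assms(2,3)
  proof (induction n arbitrary: y)
    case 0
    then show ?case by simp
  next
    case (Suc n)
    \<comment> \<open>The term \<open>k = 0\<close> equals \<open>y\<close> because
      \<open>0 \<le> y\<close>; the rest is the sum for \<open>y - h\<close>.\<close>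
    have shift: "(\<Sum>k<Suc n. max (y - real k * h) 0) = y + (\<Sum>k<n. max ((y - h) - real k * h) 0)"
      using Suc.prems unfolding sum.lessThan_Suc_shift by (simp add: algebra_simps)
    show ?case
    proof (cases "h \<le> y")
      case True
      define S where "S = (\<Sum>k<n. max ((y - h) - real k * h) 0)"
      have IH: "(y - h)\<^sup>2 \<le> 2 * h * S" "2 * h * S \<le> (y - h)\<^sup>2 + 2 * h * (y - h)"
        using Suc.IH[of "y - h"] Suc.prems True unfolding S_def by (auto simp: algebra_simps)
      \<comment> \<open>After inserting the induction hypothesis, both bounds hold with
        \<open>h^2\<close> to spare.\<close>
      have "(y - h)\<^sup>2 = y\<^sup>2 - 2 * h * y + h\<^sup>2" "2 * h * (y - h) = 2 * h * y - 2 * h\<^sup>2"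
        "2 * h * (y + S) = 2 * h * y + 2 * h * S" "0 \<le> h\<^sup>2"
        by (simp_all add: power2_eq_square algebra_simps)
      with IH show ?thesis unfolding shift S_def[symmetric] by linarith
    next
      case False
      \<comment> \<open>Only the first term survives, so the bounds reduce to
        \<open>y^2 \<le> 2 * h * y\<close> and \<open>0 \<le> y^2\<close>.\<close>
      have "(\<Sum>k<n. max ((y - h) - real k * h) 0) = 0"
      proof (rule sum.neutral, rule ballI)
        fix k
        have "0 \<le> real k * h" using \<open>0 \<le> h\<close> by simp
        then show "max ((y - h) - real k * h) 0 = 0" using False by (simp add: max_def)
      qed
      moreover have "y * y \<le> h * y" using False Suc.prems by (intro mult_right_mono) auto
      moreover have "0 \<le> h * y" using \<open>0 \<le> h\<close> Suc.prems by simp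
      ultimately show ?thesis unfolding shift by (simp add: power2_eq_square)
    qed
  qed
  then show "y\<^sup>2 \<le> 2 * h * (\<Sum>k<n. max (y - real k * h) 0)"
    and "2 * h * (\<Sum>k<n. max (y - real k * h) 0) \<le> y\<^sup>2 + 2 * h * y" by auto
qed

text \<open>With mesh \<open>L / 2^m\<close> the Riemann sum is \<open>2 * L\<close> times an
  average of \<open>2^m\<close> functions \<open>(f - a)^+\<close> with
  \<open>0 \<le> a \<le> L\<close>, whose form values have a common finite bound because constants
  lie in the domain.\<close>

lemma form_domain_square_nonneg:
  assumes "semi_finite M" and energy: "energy_form M E" and one: "(\<lambda>_. 1) \<in> form_domain M E"
    and f: "f \<in> form_domain M E" and L: "0 \<le> L" and bounds: "AE x in M. 0 \<le> f x \<and> f x \<le> L"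
  shows "(\<lambda>x. (f x)\<^sup>2) \<in> form_domain M E"
proof (rule form_domainI)
  have closed: "closed_form M E" and q: "quadratic_form M E"
    using energy by (simp_all add: energy_form_def closed_form_def)
  have [measurable]: "f \<in> borel_measurable M" using f by (rule form_domain_measurable)
  show "(\<lambda>x. (f x)\<^sup>2) \<in> borel_measurable M" by measurable
  define h where "h m = L / 2^m" for m :: nat
  \<comment> \<open>From \<open>E (f - a) \<le> 2 * E f + 2 * a^2 * E 1\<close> and
    \<open>a \<le> L\<close>.\<close>
  define B where "B = 2 * E f + 2 * (ennreal (L\<^sup>2) * E (\<lambda>_. 1))"
  \<comment> \<open>Truncation at \<open>L\<close> bounds the shift for every natural
    \<open>k\<close>, as the averaging lemma requires; for \<open>k < 2^m\<close> it changes
    nothing.\<close>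
  define u where "u m k x = max (f x - min (real k * h m) L) 0" for m k x
  have [measurable]: "u m k \<in> borel_measurable M" for m k unfolding u_def by measurable
  have u_le: "E (u m k) \<le> B" for m k
  proof -
    define a where "a = min (real k * h m) L"
    have a: "0 \<le> a" "a \<le> L" using L by (auto simp: a_def h_def)
    have "E (u m k) \<le> E (\<lambda>x. f x + (- a) * 1)"
      using energy_form_pos_part_le[OF assms(1) energy, of "\<lambda>x. f x - a"]
      by (simp add: u_def[abs_def] a_def)
    also have "\<dots> \<le> 2 * E f + 2 * E (\<lambda>x. (- a) * 1)"
      by (rule quadratic_form_add_le[OF q]) auto
    also have "E (\<lambda>x. (- a) * 1) = ennreal ((- a)\<^sup>2) * E (\<lambda>_. 1)"
      by (rule quadratic_form_scale[OF q]) auto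
    also have "2 * E f + 2 * (ennreal ((- a)\<^sup>2) * E (\<lambda>_. 1)) \<le> B"
      unfolding B_def using a
      by (intro add_left_mono mult_left_mono mult_right_mono ennreal_leI) (auto intro: power_mono)
    finally show ?thesis .
  qed
  \<comment> \<open>Here \<open>2 * L / 2^m = 2 * h m\<close> is the prefactor of the Riemann
    sum.\<close>
  define s where "s m x = 2 * L * ((\<Sum>k<2^m. u m k x) / 2^m)" for m x
  have "E (\<lambda>x. (f x)\<^sup>2) \<le> ennreal ((2 * L)\<^sup>2) * B"
  proof (rule closed_form_Fatou[OF assms(1) closed, of s])
    fix m
    show "s m \<in> borel_measurable M" unfolding s_def by measurable
    have "E (s m) = ennreal ((2 * L)\<^sup>2) * E (\<lambda>x. (\<Sum>k<2^m. u m k x) / 2^m)"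
      unfolding s_def[abs_def] by (rule quadratic_form_scale[OF q]) measurable
    also have "\<dots> \<le> ennreal ((2 * L)\<^sup>2) * B"
      by (intro mult_left_mono quadratic_form_dyadic_average_le[OF q] u_le) auto
    finally show "E (s m) \<le> ennreal ((2 * L)\<^sup>2) * B" .
  next
    show "AE x in M. (\<lambda>m. s m x) \<longlonglongrightarrow> (f x)\<^sup>2"
      using bounds
    proof eventually_elim
      case (elim x)
      have s_eq: "s m x = 2 * h m * (\<Sum>k<2^m. max (f x - real k * h m) 0)" for m
      proof -
        have "u m k x = max (f x - real k * h m) 0" if "k < 2^m" for k
        proof -
          have "real k * h m \<le> 2^m * h m"
            using that L by (intro mult_right_mono) (auto simp: h_def less_imp_le)
          then show ?thesis by (simp add: u_def h_def)
        qed
        then show ?thesis by (simp add: s_def h_def)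
      qed
      have h: "0 \<le> h m" "f x \<le> real (2^m) * h m" for m using L elim by (auto simp: h_def)
      have h_lim: "h \<longlonglongrightarrow> 0"
        unfolding h_def by (rule LIMSEQ_divide_realpow_zero) simp
      show ?case
      proof (rule tendsto_sandwich)
        show "\<forall>\<^sub>F m in sequentially. (f x)\<^sup>2 \<le> s m x"
          unfolding s_eq using h elim by (intro always_eventually allI square_Riemann_sum_bounds(1)) auto
        show "\<forall>\<^sub>F m in sequentially. s m x \<le> (f x)\<^sup>2 + 2 * h m * f x"
          unfolding s_eq using h elim by (intro always_eventually allI square_Riemann_sum_bounds(2)) auto
        have "(\<lambda>m. (f x)\<^sup>2 + 2 * h m * f x) \<longlonglongrightarrow> (f x)\<^sup>2 + 2 * 0 * f x"
          by (intro tendsto_add tendsto_mult tendsto_const h_lim)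
        then show "(\<lambda>m. (f x)\<^sup>2 + 2 * h m * f x) \<longlonglongrightarrow> (f x)\<^sup>2" by simp
      qed (rule tendsto_const)
    qed
  qed measurable
  also have "\<dots> < \<infinity>"
    unfolding B_def using f one by (simp add: form_domain_def ennreal_mult_less_top)
  finally show "E (\<lambda>x. (f x)\<^sup>2) < \<infinity>" .
qed

text \<open>A constant shift makes \<open>f\<close> nonnegative a.e.; expanding
  \<open>(f + c)^2\<close> recovers \<open>f^2\<close> up to a multiple of \<open>f\<close> and a
  constant, both in the domain.\<close>

lemma form_domain_square:
  assumes "semi_finite M" and energy: "energy_form M E" and one: "(\<lambda>_. 1) \<in> form_domain M E"
    and f: "f \<in> form_domain M E" "f \<in> ess_bounded M"
  shows "(\<lambda>x. (f x)\<^sup>2) \<in> form_domain M E"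
proof -
  have q: "quadratic_form M E" using energy by (simp add: energy_form_def closed_form_def)
  obtain c0 where c0: "AE x in M. \<bar>f x\<bar> \<le> c0" using f(2) unfolding ess_bounded_def by blast
  \<comment> \<open>The absolute value ensures \<open>0 \<le> 2 * c\<close> even if the a.e. bound
    \<open>c0\<close> is negative, which can happen on a null space.\<close>
  define c where "c = \<bar>c0\<bar>"
  have "AE x in M. 0 \<le> f x + c \<and> f x + c \<le> 2 * c" using c0 by eventually_elim (auto simp: c_def)
  then have "(\<lambda>x. (f x + c)\<^sup>2) \<in> form_domain M E"
    by (intro form_domain_square_nonneg[OF assms(1-3) form_domain_add_const[OF q f(1) one],
          where L = "2 * c"]) (auto simp: c_def)
  then have "(\<lambda>x. (f x + c)\<^sup>2 - (2 * c) * f x + - c\<^sup>2) \<in> form_domain M E"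
    by (intro form_domain_add_const[OF q form_domain_diff[OF q _ form_domain_scale[OF q f(1)]] one])
  moreover have "(\<lambda>x. (f x + c)\<^sup>2 - (2 * c) * f x + - c\<^sup>2) = (\<lambda>x. (f x)\<^sup>2)"
    by (auto simp: power2_eq_square algebra_simps)
  ultimately show ?thesis by simp
qed

text \<open>Polarization: \<open>4 * f * g = (f + g)^2 - (f - g)^2\<close>. This supplies the ideal
  property of \<open>E\<close> in itself.\<close>

lemma form_domain_mult:
  assumes "semi_finite M" and energy: "energy_form M E" and one: "(\<lambda>_. 1) \<in> form_domain M E"
    and f: "f \<in> form_domain M E" "f \<in> ess_bounded M"
    and g: "g \<in> form_domain M E" "g \<in> ess_bounded M"
  shows "(\<lambda>x. f x * g x) \<in> form_domain M E"
proof -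
  have q: "quadratic_form M E" using energy by (simp add: energy_form_def closed_form_def)
  have [measurable]: "f \<in> borel_measurable M" "g \<in> borel_measurable M"
    using f g by (simp_all add: ess_bounded_def)
  obtain a b where ab: "AE x in M. \<bar>f x\<bar> \<le> a" "AE x in M. \<bar>g x\<bar> \<le> b"
    using f(2) g(2) unfolding ess_bounded_def by blast
  have "AE x in M. \<bar>f x + g x\<bar> \<le> a + b" using ab by eventually_elim linarith
  then have add: "(\<lambda>x. f x + g x) \<in> ess_bounded M" by (rule ess_boundedI[rotated]) measurable
  have "AE x in M. \<bar>f x - g x\<bar> \<le> a + b" using ab by eventually_elim linarith
  then have diff: "(\<lambda>x. f x - g x) \<in> ess_bounded M" by (rule ess_boundedI[rotated]) measurable
  have "(\<lambda>x. 1/4 * ((f x + g x)\<^sup>2 - (f x - g x)\<^sup>2)) \<in> form_domain M E"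
    by (intro form_domain_scale[OF q form_domain_diff[OF q]] form_domain_square[OF assms(1-3)]
        form_domain_add[OF q f(1) g(1)] form_domain_diff[OF q f(1) g(1)] add diff)
  moreover have "(\<lambda>x. 1/4 * ((f x + g x)\<^sup>2 - (f x - g x)\<^sup>2)) = (\<lambda>x. f x * g x)"
    by (auto simp: power2_eq_square algebra_simps)
  ultimately show ?thesis by simp
qed

section \<open>Silverstein extensions\<close>

lemma Silverstein_extension_domain_subset:
  assumes "semi_finite M" and energy: "energy_form M E" and one: "(\<lambda>_. 1) \<in> form_domain M E"
    and ext: "Silverstein_extension M E E'"
  shows "form_domain M E' \<subseteq> form_domain M E"
proof -
  have closed: "closed_form M E" and q: "quadratic_form M E"
    using energy by (simp_all add: energy_form_def closed_form_def)
  have q': "quadratic_form M E'" and Markov': "Markovian M E'"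
    and agree: "\<And>g. g \<in> form_domain M E \<Longrightarrow> E' g = E g"
    and ideal: "\<And>f g. f \<in> form_domain M E \<inter> ess_bounded M \<Longrightarrow> g \<in> form_domain M E' \<inter> ess_bounded M
      \<Longrightarrow> (\<lambda>x. f x * g x) \<in> form_domain M E"
    using ext by (auto simp: Silverstein_extension_def energy_form_def closed_form_def form_extension_def)
  \<comment> \<open>The constant serves as the factor from \<open>D(E)\<close> in the ideal
    property, since \<open>1 * g = g\<close>.\<close>
  have one': "(\<lambda>_. 1) \<in> form_domain M E \<inter> ess_bounded M"
    using one by (auto intro!: ess_boundedI[of _ _ 1])
  \<comment> \<open>The bounded approximants have finite \<open>E'\<close>, so the ideal property
    puts them into \<open>D(E)\<close>, where the two forms agree; the bound \<open>E' f\<close>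
    then survives the limit by lower semicontinuity of \<open>E\<close>.\<close>
  have pos: "(\<lambda>x. max (f x) 0) \<in> form_domain M E" if f: "f \<in> form_domain M E'" for f
  proof (rule form_domainI)
    have m [measurable]: "f \<in> borel_measurable M" using f by (rule form_domain_measurable)
    show "(\<lambda>x. max (f x) 0) \<in> borel_measurable M" by measurable
    obtain p where p: "\<And>n. p n \<in> ess_bounded M" "\<And>n. E' (p n) \<le> E' f"
      "\<And>x. (\<lambda>n. p n x) \<longlonglongrightarrow> max (f x) 0"
      using Markovian_bounded_approximation[OF q' Markov' m] by blast
    have pE': "p n \<in> form_domain M E' \<inter> ess_bounded M" for n
      using p(1)[of n] order_le_less_trans[OF p(2) form_domain_finite[OF f]]
      by (auto simp: ess_bounded_def intro!: form_domainI)
    then have pE: "p n \<in> form_domain M E" for n using ideal[OF one' pE'[of n]] by simp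
    have "E (\<lambda>x. max (f x) 0) \<le> E' f"
    proof (rule closed_form_Fatou[OF assms(1) closed, of p])
      show "p n \<in> borel_measurable M" for n using pE by (rule form_domain_measurable)
      show "E (p n) \<le> E' f" for n using p(2)[of n] agree[OF pE] by simp
    qed (use p(3) in auto)
    also have "\<dots> < \<infinity>" using f by (rule form_domain_finite)
    finally show "E (\<lambda>x. max (f x) 0) < \<infinity>" .
  qed
  show ?thesis
  proof
    fix f assume f: "f \<in> form_domain M E'"
    \<comment> \<open>The negative part of \<open>f\<close> is the positive part of
      \<open>(-1) * f\<close>, which lies in \<open>D(E')\<close> as well.\<close>
    have "(\<lambda>x. max (f x) 0 - max ((-1) * f x) 0) \<in> form_domain M E"
      using pos[OF f] pos[OF form_domain_scale[OF q' f]] by (rule form_domain_diff[OF q])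
    moreover have "(\<lambda>x. max (f x) 0 - max ((-1) * f x) 0) = f" by (auto simp: max_def)
    ultimately show "f \<in> form_domain M E" by simp
  qed
qed

text \<open>Equality of the domains suffices: an extension agrees with \<open>E\<close> on
  \<open>D(E)\<close>, and outside the common domain both forms are infinite.\<close>

lemma Silverstein_unique_if_one_in_domain:
  fixes M :: "'a measure"
  assumes "semi_finite M" and energy: "energy_form M E" and one: "(\<lambda>_. 1) \<in> form_domain M E"
  shows "Silverstein_unique M E"
  unfolding Silverstein_unique_def
proof (intro conjI allI impI ballI)
  show "Silverstein_extension M E E"
    unfolding Silverstein_extension_def form_extension_def
    using energy form_domain_mult[OF assms] by blast
  fix E' :: "('a \<Rightarrow> real) \<Rightarrow> ennreal" and f :: "'a \<Rightarrow> real"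
  assume ext: "Silverstein_extension M E E'" and m: "f \<in> borel_measurable M"
  show "E' f = E f"
  proof (cases "f \<in> form_domain M E")
    case True
    then show ?thesis using ext by (simp add: Silverstein_extension_def form_extension_def)
  next
    case False
    then have "f \<notin> form_domain M E'" using Silverstein_extension_domain_subset[OF assms ext] by blast
    with False m show ?thesis by (simp add: form_domain_def less_top[symmetric])
  qed
qed

theorem theorem3p21:
  fixes M :: "'a measure" and E :: "('a \<Rightarrow> real) \<Rightarrow> ennreal"
  assumes "localizable M" and "energy_form M E"
  shows "((\<lambda>_. 1) \<in> form_domain M E \<longrightarrow> Silverstein_unique M E) \<and>
    (recurrent M E \<longrightarrow> Silverstein_unique M E)"
proof -
  have "semi_finite M" using assms(1) by (simp add: localizable_def)
  moreover have "(\<lambda>_. 1) \<in> form_domain M E" if "recurrent M E"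
    using that by (simp add: recurrent_def form_kernel_def form_domain_def)
  ultimately show ?thesis using Silverstein_unique_if_one_in_domain assms(2) by blast
qed

end
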